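(* Assume the smoothness, Lyapunov, second-order-growth, regularity, contraction and state-evolution assumptions stated in the context, and let $\bar a=a_3/a_2$, $\mu$, $\hat\gamma$ and $\kappa=\kappa(T)$ be the constants defined in the context. Then there exists $T^*>0$ such that for every sampling time $T\in(0,T^*]$ the origin $(\nu,\epsilon)=(0,0)$ is asymptotically stable for the linear discrete-time system (auxiliary dynamics) $$\nu_+=(1-T\bar a)^{1/2}\,\nu+(T\mu)^{1/2}\,\epsilon,\qquad \epsilon_+=T\hat\gamma\,\nu+\kappa\,\epsilon,$$ with states $\nu,\epsilon\in\mathbb{R}$.
   Context: Notation. $\|\cdot\|$ is the Euclidean norm for vectors and the spectral norm for matrices; $\mathcal{B}(x,r)=\{y:\|x-y\|\le r\}$; $\nabla f$ is the transposed Jacobian. Problem. For a parameter $x\in\mathbb{R}^{n_x}$, $P(x)$ is the problem $\min_{y\in\mathbb{R}^n} f(y)$ s.t. $g(y)+Bx=0$, with $f:\mathbb{R}^n\to\mathbb{R}$, $g:\mathbb{R}^n\to\mathbb{R}^{n_g}$, $B\in\mathbb{R}^{n_g\times n_x}$ constant. $X$ is the set of $x$ for which $P(x)$ has a solution; $\bar y(x)$ solves $P(x)$; $V(x)=f(\bar y(x))$; $\bar V>0$ is fixed and $X_{\bar V}=\{x: V(x)\le\bar V\}$. An inequality involving $V$ at a point includes the assertion that the point lies in $X$. With $z=(y,\lambda)\in\mathbb{R}^{n_z}$, $n_z=n+n_g$, the first-order optimality conditions are $F(z)+Cx=0$, where $F(z)=(\nabla f(y)+\nabla g(y)\lambda,\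 g(y))$ and $C=[0\ \ B^\top]^\top$; $\bar Z(x)$ is the set of $z$ satisfying them. The feedback policy is $\bar u(x)=M_{u,y}\bar y(x)$ with a constant projection (selection) matrix $M_{u,y}$, $\|M_{u,y}\|=1$; $M_{u,z}$ is the corresponding projection with $M_{u,z}z=M_{u,y}y$, $\|M_{u,z}\|=1$. System. $\psi(t;x_0,u_0)$ is the solution of $\frac{d}{dt}\psi=\phi(\psi,u_0)$, $\psi(0;x_0,u_0)=x_0$, for constant input $u_0\in\mathbb{R}^{n_u}$, where $\phi:\mathbb{R}^{n_x}\times\mathbb{R}^{n_u}\to\mathbb{R}^{n_x}$, $\phi(0,0)=0$. The number $T>0$ is the sampling time. Optimizer. One iteration of the optimizer for parameter value $x$ maps $z$ to $\varphi(x,z)$, $\varphi:\mathbb{R}^{n_x}\times\mathbb{R}^{n_z}\to\mathbb{R}^{n_z}$. The coupled dynamics are $x_+=\psi(T;x,M_{u,z}z)$, $z_+=\varphi(x_+,z)$. Assumptions. Smoothness: $f,g$ are twice continuously differentiable with bounded first and second order derivatives. Lyapunov: there are positive constants $a_1,a_2,a_3,T_0$ such that for all $x\in X_{\bar V}$ and $0<T\le T_0$: $a_1\|x\|^2\le V(x)\le a_2\|x\|^2$ and $V(\psi(T;x,\bar u(x)))-V(x)\le -T a_3\|x\|^2$. Second-order growth: for all $u\in\mathbb{R}^{n_u}$, $x\in X_{\bar V}$, $0<T\le T_0$: $V(\psi(T;x,u))-V(x)\le -Ta_3\|x\|^2+T\,O(\|u-\bar u(x)\|^2)$, where the $O$-term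 is bounded by a constant times $\|u-\bar u(x)\|^2$ for $\|u-\bar u(x)\|$ small, uniformly in $x\in X_{\bar V}$ and $T\in(0,T_0]$. Regularity: for every $x\in X_{\bar V}$ there is a unique solution $\bar z(x)$ of $F(z)+Cx=0$ (with primal part $\bar y(x)$), second order sufficient conditions hold at $\bar z(x)$, and $\bar Z(0)=\{0\}$, i.e. $\bar z(0)=0$. Contraction: there are $\hat r_z>0$ and $0<\hat\kappa<1$ such that for all $x\in X_{\bar V}$ and $z\in\mathcal{B}(\bar z(x),\hat r_z)$, $\|\varphi(x,z)-\bar z(x)\|\le\hat\kappa\|z-\bar z(x)\|$. State evolution: there are positive finite constants $L_{\psi,x},L_{\psi,u}$ such that for all $x\in X_{\bar V}$, all $z$ with $\|z-\bar z(x)\|\le r_z$ and all $0<T\le T_0$, $\|\psi(T;x,M_{u,z}z)-x\|\le T(L_{\psi,x}\|x\|+L_{\psi,u}\|M_{u,z}z\|)$. Constants. $\sigma>0$ is a Lipschitz constant of $x\mapsto\bar z(x)$ on $X_{\bar V}$; $r_z,r_x>0$ are such that for all $x\in X_{\bar V}$, $z\in\mathcal{B}(\bar z(x),r_z)$, $x_+\in\mathcal{B}(x,r_x)$, with $z_+=\varphi(x_+,z)$: $\|z_+-\bar z(x_+)\|\le\hat\kappa\|z-\bar z(x)\|+\sigma\hat\kappa\|x_+-x\|$. Set $\eta=L_{\psi,x}+L_{\psi,u}\sigma$, $\theta=L_{\psi,u}$, $\kappa=\hat\kappa(1+T\sigma\theta)$, $\gamma=\sigma\hat\kappa\eta$,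 $\hat\gamma=\gamma/\sqrt{a_1}$, $\bar a=a_3/a_2$. The constant $\mu>0$ (together with $0<\bar V_q\le\bar V$, $0<r_q\le r_z$) is such that $V(\psi(T;x,M_{u,z}z))\le(1-T\bar a)V(x)+T\mu\|z-\bar z(x)\|^2$ whenever $V(x)\le\bar V_q$, $\|z-\bar z(x)\|\le r_q$, $0<T\le T_0$. All constants except $\kappa$ are independent of $T$. *)

theory Defs
  imports "HOL-Analysis.Analysis"
begin

definition bounded_C2 :: "('a::real_normed_vector \<Rightarrow> 'b::real_normed_vector) \<Rightarrow> bool" where
  "bounded_C2 f \<longleftrightarrow>
    (\<exists>(f' :: 'a \<Rightarrow> 'a \<Rightarrow>\<^sub>L 'b) (f'' :: 'a \<Rightarrow> 'a \<Rightarrow>\<^sub>L 'a \<Rightarrow>\<^sub>L 'b).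
       (\<forall>y. (f has_derivative blinfun_apply (f' y)) (at y)) \<and>
       (\<forall>y. (f' has_derivative blinfun_apply (f'' y)) (at y)) \<and>
       continuous_on UNIV f'' \<and> bounded (range f') \<and> bounded (range f''))"

definition grad :: "(real^'n \<Rightarrow> real) \<Rightarrow> real^'n \<Rightarrow> real^'n" where
  "grad f y = (\<chi> i. frechet_derivative f (at y) (axis i 1))"

definition hessian :: "(real^'n \<Rightarrow> real) \<Rightarrow> real^'n \<Rightarrow> real^'n^'n" where
  "hessian f y = jacobian (grad f) (at y)"

text \<open>The problem with parameter \<open>x\<close> is to minimize \<open>f y\<close> subject to \<open>g y + B *v x = 0\<close>;
  solutions are global minimizers.\<close>

definition solves_problem ::
    "(real^'n \<Rightarrow> real) \<Rightarrow> (real^'n \<Rightarrow> real^'g) \<Rightarrow> real^'x^'g \<Rightarrow> real^'x \<Rightarrow> real^'n \<Rightarrow> bool" where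
  "solves_problem f g B x y \<longleftrightarrow> is_arg_min f (\<lambda>y. g y + B *v x = 0) y"

definition solvable_params ::
    "(real^'n \<Rightarrow> real) \<Rightarrow> (real^'n \<Rightarrow> real^'g) \<Rightarrow> real^'x^'g \<Rightarrow> (real^'x) set" where
  "solvable_params f g B = {x. \<exists>y. solves_problem f g B x y}"

text \<open>Primal-dual pairs \<open>z = (y, l)\<close> live in the product type, whose norm is the Euclidean norm
  of the stacked vector. The gradient of \<open>g\<close> is the transposed Jacobian.\<close>

definition kkt_map ::
    "(real^'n \<Rightarrow> real) \<Rightarrow> (real^'n \<Rightarrow> real^'g) \<Rightarrow> (real^'n) \<times> (real^'g) \<Rightarrow> (real^'n) \<times> (real^'g)" where
  "kkt_map f g z =
     (grad f (fst z) + transpose (jacobian g (at (fst z))) *v snd z, g (fst z))"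

definition param_map :: "real^'x^'g \<Rightarrow> real^'x \<Rightarrow> (real^'n) \<times> (real^'g)" where
  "param_map B x = (0, B *v x)"

definition kkt_points ::
    "(real^'n \<Rightarrow> real) \<Rightarrow> (real^'n \<Rightarrow> real^'g) \<Rightarrow> real^'x^'g \<Rightarrow> real^'x \<Rightarrow> ((real^'n) \<times> (real^'g)) set" where
  "kkt_points f g B x = {z. kkt_map f g z + param_map B x = 0}"

definition lagrangian ::
    "(real^'n \<Rightarrow> real) \<Rightarrow> (real^'n \<Rightarrow> real^'g) \<Rightarrow> real^'g \<Rightarrow> real^'n \<Rightarrow> real" where
  "lagrangian f g l y = f y + l \<bullet> g y"

text \<open>The constraints are equalities, so the critical cone is the kernel of the Jacobian of \<open>g\<close>.\<close>

definition second_order_sufficient ::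
    "(real^'n \<Rightarrow> real) \<Rightarrow> (real^'n \<Rightarrow> real^'g) \<Rightarrow> real^'x^'g \<Rightarrow> real^'x \<Rightarrow> (real^'n) \<times> (real^'g) \<Rightarrow> bool" where
  "second_order_sufficient f g B x z \<longleftrightarrow>
     z \<in> kkt_points f g B x \<and>
     (\<forall>d. d \<noteq> 0 \<and> jacobian g (at (fst z)) *v d = 0 \<longrightarrow>
        d \<bullet> (hessian (lagrangian f g (snd z)) (fst z) *v d) > 0)"

definition selection_matrix :: "real^'n^'u \<Rightarrow> bool" where
  "selection_matrix M \<longleftrightarrow> (\<forall>i. \<exists>j. row i M = axis j 1)"

definition is_flow :: "('x::real_normed_vector \<Rightarrow> 'u \<Rightarrow> 'x) \<Rightarrow> (real \<Rightarrow> 'x \<Rightarrow> 'u \<Rightarrow> 'x) \<Rightarrow> bool" where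
  "is_flow \<phi> \<psi> \<longleftrightarrow>
     (\<forall>x\<^sub>0 u\<^sub>0. \<psi> 0 x\<^sub>0 u\<^sub>0 = x\<^sub>0 \<and>
        (\<forall>t\<ge>0. ((\<lambda>t. \<psi> t x\<^sub>0 u\<^sub>0) has_vector_derivative \<phi> (\<psi> t x\<^sub>0 u\<^sub>0) u\<^sub>0) (at t within {0..})))"

text \<open>Asymptotic stability of an equilibrium \<open>p\<close> of \<open>s\<^sub>+ = h s\<close>: Lyapunov stability and
  local attractivity.\<close>

definition asymptotically_stable :: "('a::metric_space \<Rightarrow> 'a) \<Rightarrow> 'a \<Rightarrow> bool" where
  "asymptotically_stable h p \<longleftrightarrow>
     h p = p \<and>
     (\<forall>e>0. \<exists>d>0. \<forall>s. dist s p < d \<longrightarrow> (\<forall>k. dist ((h ^^ k) s) p < e)) \<and>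
     (\<exists>d>0. \<forall>s. dist s p < d \<longrightarrow> (\<lambda>k. (h ^^ k) s) \<longlonglongrightarrow> p)"

end

theory Submission
  imports Defs
begin

text \<open>
  The auxiliary system is linear with a nonnegative matrix, so a weighted \<open>l\<^sup>1\<close> norm
  \<open>\<bar>\<nu>\<bar> + w \<bar>\<epsilon>\<bar>\<close> contracts as soon as both weighted column sums are below their weights. The
  point is that one weight \<open>w\<close>, independent of \<open>T\<close>, serves for all small \<open>T\<close>:

  \<^item> In the first column, \<open>sqrt (1 - T abar) \<le> 1 - T abar / 2\<close>. The state thus loses at least
    \<open>T abar / 2\<close>, while the feedback into the optimizer error costs \<open>w T \<gamma>hat\<close>, which is of the
    same order in \<open>T\<close>. The choice \<open>w = abar / (4 \<gamma>hat)\<close> makes it half of the gain, whatever \<open>T\<close> is.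
  \<^item> In the second column, the requirement is \<open>sqrt (T \<mu>) + w \<kappa> T < w\<close>. As \<open>T\<close> tends to \<open>0\<close> its
    left side tends to \<open>w \<kappa>hat\<close>, and \<open>\<kappa>hat < 1\<close>, so it holds for all small \<open>T\<close>.

  The contraction factor itself tends to \<open>1\<close> with \<open>T\<close>, but a factor below \<open>1\<close> for each fixed \<open>T\<close>
  is all that asymptotic stability asks for.
\<close>

text \<open>A Lyapunov function that decays geometrically and is comparable to the distance: the
  iterates obey \<open>dist ((h ^^ k) s) p \<le> c C q\<^sup>k dist s p\<close>, which gives both stability and
  (even global) attractivity.\<close>

lemma asymptotically_stable_if_geometric_decay:
  fixes h :: "'a::metric_space \<Rightarrow> 'a" and W :: "'a \<Rightarrow> real"
  assumes fixed: "h p = p"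
    and q: "0 \<le> q" "q < 1"
    and decay: "\<And>s. W (h s) \<le> q * W s"
    and lower: "\<And>s. dist s p \<le> c * W s"
    and upper: "\<And>s. W s \<le> C * dist s p"
    and pos: "c > 0" "C > 0"
  shows "asymptotically_stable h p"
proof -
  have W_iter: "W ((h ^^ k) s) \<le> q ^ k * W s" for k s
  proof (induction k)
    case (Suc k)
    have "W ((h ^^ Suc k) s) \<le> q * W ((h ^^ k) s)"
      using decay by simp
    also have "\<dots> \<le> q * (q ^ k * W s)"
      using Suc q by (intro mult_left_mono)
    finally show ?case by (simp add: mult.assoc)
  qed simp
  have iter: "dist ((h ^^ k) s) p \<le> c * C * dist s p * q ^ k" for k s
  proof -
    have "dist ((h ^^ k) s) p \<le> c * W ((h ^^ k) s)"
      by (rule lower)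
    also have "\<dots> \<le> c * (q ^ k * W s)"
      using W_iter pos by (intro mult_left_mono) auto
    also have "\<dots> \<le> c * (q ^ k * (C * dist s p))"
      using upper pos q by (intro mult_left_mono) auto
    finally show ?thesis by (simp add: mult_ac)
  qed
  have stable: "\<exists>d>0. \<forall>s. dist s p < d \<longrightarrow> (\<forall>k. dist ((h ^^ k) s) p < e)" if "e > 0" for e
  proof (intro exI[of _ "e / (c * C)"] conjI allI impI)
    fix s k
    assume "dist s p < e / (c * C)"
    then have "c * C * dist s p < e"
      using pos by (simp add: field_simps)
    moreover have "c * C * dist s p * q ^ k \<le> c * C * dist s p"
      using pos q by (intro mult_left_le) (simp_all add: power_le_one)
    ultimately show "dist ((h ^^ k) s) p < e"
      using iter[of k s] by linarith
  qed (use that pos in simp)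
  have "(\<lambda>k. (h ^^ k) s) \<longlonglongrightarrow> p" for s
  proof -
    have "(\<lambda>k. c * C * dist s p * q ^ k) \<longlonglongrightarrow> 0"
      using q by (intro tendsto_mult_right_zero LIMSEQ_realpow_zero)
    then have "(\<lambda>k. dist ((h ^^ k) s) p) \<longlonglongrightarrow> 0"
      by (rule Lim_null_comparison[rotated]) (simp add: iter)
    then show ?thesis
      by (rule tendsto_dist_iff[THEN iffD2])
  qed
  then show ?thesis
    unfolding asymptotically_stable_def
    using fixed stable by (intro conjI exI[of _ 1]) simp_all
qed

text \<open>The column-sum criterion: the hypotheses say that a positive row vector \<open>(1, w)\<close> is
  strictly decreased by multiplication with the matrix from the right, so that
  \<open>\<bar>\<nu>\<bar> + w \<bar>\<epsilon>\<bar>\<close> is a geometrically decaying Lyapunov function.\<close>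

lemma asymptotically_stable_nonneg_matrix2:
  fixes a b c d w :: real
  assumes nonneg: "0 \<le> a" "0 \<le> b" "0 \<le> c" "0 \<le> d"
    and w: "w > 0"
    and col1: "a + w * c < 1"
    and col2: "b + w * d < w"
  shows "asymptotically_stable (\<lambda>(\<nu>, \<epsilon>). (a * \<nu> + b * \<epsilon>, c * \<nu> + d * \<epsilon>)) (0, 0)"
proof -
  define q where "q = max (a + w * c) ((b + w * d) / w)"
  have q: "0 \<le> q" "q < 1"
    using assms by (auto simp: q_def le_max_iff_disj)
  have q1: "a + w * c \<le> q" and q2: "b + w * d \<le> q * w"
    using w by (auto simp: q_def pos_divide_le_eq[symmetric])
  define W :: "real \<times> real \<Rightarrow> real" where "W = (\<lambda>(\<nu>, \<epsilon>). \<bar>\<nu>\<bar> + w * \<bar>\<epsilon>\<bar>)"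
  show ?thesis
  proof (rule asymptotically_stable_if_geometric_decay[where W = W and q = q
        and c = "1 + 1 / w" and C = "1 + w"])
    fix s :: "real \<times> real"
    obtain \<nu> \<epsilon> where s: "s = (\<nu>, \<epsilon>)" by (cases s)
    have "\<bar>a * \<nu> + b * \<epsilon>\<bar> \<le> a * \<bar>\<nu>\<bar> + b * \<bar>\<epsilon>\<bar>"
      using abs_triangle_ineq[of "a * \<nu>" "b * \<epsilon>"] nonneg by (simp add: abs_mult)
    moreover have "w * \<bar>c * \<nu> + d * \<epsilon>\<bar> \<le> w * (c * \<bar>\<nu>\<bar> + d * \<bar>\<epsilon>\<bar>)"
      using abs_triangle_ineq[of "c * \<nu>" "d * \<epsilon>"] nonneg w
      by (intro mult_left_mono) (simp_all add: abs_mult)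
    ultimately have "\<bar>a * \<nu> + b * \<epsilon>\<bar> + w * \<bar>c * \<nu> + d * \<epsilon>\<bar>
        \<le> (a + w * c) * \<bar>\<nu>\<bar> + (b + w * d) * \<bar>\<epsilon>\<bar>"
      by (simp add: algebra_simps)
    also have "\<dots> \<le> q * \<bar>\<nu>\<bar> + (q * w) * \<bar>\<epsilon>\<bar>"
      using q1 q2 by (intro add_mono mult_right_mono) auto
    finally show "W ((\<lambda>(\<nu>, \<epsilon>). (a * \<nu> + b * \<epsilon>, c * \<nu> + d * \<epsilon>)) s) \<le> q * W s"
      by (simp add: s W_def algebra_simps)
    have "dist s (0, 0) = norm s"
      by (simp add: dist_norm flip: zero_prod_def)
    moreover have "norm s \<le> \<bar>\<nu>\<bar> + \<bar>\<epsilon>\<bar>"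
      using norm_Pair_le[of \<nu> \<epsilon>] by (simp add: s)
    moreover have "\<bar>\<nu>\<bar> + \<bar>\<epsilon>\<bar> \<le> (1 + 1 / w) * W s"
      using w by (simp add: s W_def field_simps)
    ultimately show "dist s (0, 0) \<le> (1 + 1 / w) * W s"
      by linarith
    have "\<bar>\<nu>\<bar> \<le> norm s" "\<bar>\<epsilon>\<bar> \<le> norm s"
      using norm_fst_le[of \<nu> \<epsilon>] norm_snd_le[of \<epsilon> \<nu>] by (simp_all add: s)
    then have "W s \<le> norm s + w * norm s"
      using w unfolding W_def s by (auto intro!: add_mono mult_left_mono)
    then show "W s \<le> (1 + w) * dist s (0, 0)"
      using \<open>dist s (0, 0) = norm s\<close> by (simp add: algebra_simps)
  qed (use q w in \<open>auto simp: add_pos_pos\<close>)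
qed

lemma sqrt_one_minus_le:
  fixes u :: real
  assumes "u \<le> 1"
  shows "sqrt (1 - u) \<le> 1 - u / 2"
proof (rule real_le_lsqrt)
  have "(1 - u / 2)\<^sup>2 = 1 - u + (u / 2)\<^sup>2"
    by (simp add: power2_eq_square algebra_simps)
  then show "1 - u \<le> (1 - u / 2)\<^sup>2"
    using zero_le_power2[of "u / 2"] by linarith
qed (use assms in auto)

theorem theorem23:
  fixes f :: "real^'n \<Rightarrow> real"
    and g :: "real^'n \<Rightarrow> real^'g"
    and B :: "real^'x^'g"
    and ybar :: "real^'x \<Rightarrow> real^'n"
    and zbar :: "real^'x \<Rightarrow> (real^'n) \<times> (real^'g)"
    and X X\<^sub>V :: "(real^'x) set"
    and V :: "real^'x \<Rightarrow> real"
    and M\<^sub>u\<^sub>y :: "real^'n^'u"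
    and M\<^sub>u\<^sub>z :: "(real^'n) \<times> (real^'g) \<Rightarrow> real^'u"
    and ubar :: "real^'x \<Rightarrow> real^'u"
    and \<phi> :: "real^'x \<Rightarrow> real^'u \<Rightarrow> real^'x"
    and \<psi> :: "real \<Rightarrow> real^'x \<Rightarrow> real^'u \<Rightarrow> real^'x"
    and opt :: "real^'x \<Rightarrow> (real^'n) \<times> (real^'g) \<Rightarrow> (real^'n) \<times> (real^'g)"
    and Vbar T\<^sub>0 a\<^sub>1 a\<^sub>2 a\<^sub>3 rhat\<^sub>z \<kappa>hat L\<^sub>x L\<^sub>u \<sigma> r\<^sub>z r\<^sub>x \<eta> \<theta> \<gamma> \<gamma>hat abar \<mu> V\<^sub>q r\<^sub>q :: real
    and \<kappa> :: "real \<Rightarrow> real"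
  \<comment> \<open>parametric problem, value function and feedback policy\<close>
  assumes X_eq: "X = solvable_params f g B"
    and ybar: "\<And>x. x \<in> X \<Longrightarrow> solves_problem f g B x (ybar x)"
    and V_eq: "V = (\<lambda>x. f (ybar x))"
    and Vbar_pos: "Vbar > 0"
    and XV_eq: "X\<^sub>V = {x \<in> X. V x \<le> Vbar}"
    and Muy: "selection_matrix M\<^sub>u\<^sub>y" "onorm ((*v) M\<^sub>u\<^sub>y) = 1"
    and Muz: "M\<^sub>u\<^sub>z = (\<lambda>z. M\<^sub>u\<^sub>y *v fst z)" "onorm M\<^sub>u\<^sub>z = 1"
    and ubar_eq: "ubar = (\<lambda>x. M\<^sub>u\<^sub>y *v ybar x)"
  \<comment> \<open>system\<close>
    and flow: "is_flow \<phi> \<psi>"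
    and equilibrium: "\<phi> 0 0 = 0"
  \<comment> \<open>smoothness\<close>
    and smooth: "bounded_C2 f" "bounded_C2 g"
  \<comment> \<open>Lyapunov\<close>
    and lyap_pos: "a\<^sub>1 > 0" "a\<^sub>2 > 0" "a\<^sub>3 > 0" "T\<^sub>0 > 0"
    and lyap_bounds: "\<And>x. x \<in> X\<^sub>V \<Longrightarrow> a\<^sub>1 * (norm x)\<^sup>2 \<le> V x \<and> V x \<le> a\<^sub>2 * (norm x)\<^sup>2"
    and lyap_decrease: "\<And>x T. x \<in> X\<^sub>V \<Longrightarrow> 0 < T \<Longrightarrow> T \<le> T\<^sub>0 \<Longrightarrow>
          \<psi> T x (ubar x) \<in> X \<and> V (\<psi> T x (ubar x)) - V x \<le> - T * a\<^sub>3 * (norm x)\<^sup>2"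
  \<comment> \<open>second-order growth\<close>
    and growth: "\<exists>(R :: real \<Rightarrow> real^'x \<Rightarrow> real^'u \<Rightarrow> real) c \<delta>. \<delta> > 0 \<and>
          (\<forall>u. \<forall>x\<in>X\<^sub>V. \<forall>T. 0 < T \<and> T \<le> T\<^sub>0 \<longrightarrow>
             \<psi> T x u \<in> X \<and> V (\<psi> T x u) - V x \<le> - T * a\<^sub>3 * (norm x)\<^sup>2 + T * R T x u) \<and>
          (\<forall>u. \<forall>x\<in>X\<^sub>V. \<forall>T. 0 < T \<and> T \<le> T\<^sub>0 \<and> norm (u - ubar x) \<le> \<delta> \<longrightarrow>
             \<bar>R T x u\<bar> \<le> c * (norm (u - ubar x))\<^sup>2)"
  \<comment> \<open>regularity\<close>
    and zbar: "\<And>x. x \<in> X\<^sub>V \<Longrightarrow> kkt_points f g B x = {zbar x} \<and> fst (zbar x) = ybar x"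
    and sosc: "\<And>x. x \<in> X\<^sub>V \<Longrightarrow> second_order_sufficient f g B x (zbar x)"
    and zbar_0: "kkt_points f g B 0 = {0}" "zbar 0 = 0"
  \<comment> \<open>contraction\<close>
    and contraction_const: "rhat\<^sub>z > 0" "0 < \<kappa>hat" "\<kappa>hat < 1"
    and contraction: "\<And>x z. x \<in> X\<^sub>V \<Longrightarrow> z \<in> cball (zbar x) rhat\<^sub>z \<Longrightarrow>
          norm (opt x z - zbar x) \<le> \<kappa>hat * norm (z - zbar x)"
  \<comment> \<open>state evolution\<close>
    and evolution_const: "L\<^sub>x > 0" "L\<^sub>u > 0"
    and evolution: "\<And>x z T. x \<in> X\<^sub>V \<Longrightarrow> norm (z - zbar x) \<le> r\<^sub>z \<Longrightarrow> 0 < T \<Longrightarrow> T \<le> T\<^sub>0 \<Longrightarrow>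
          norm (\<psi> T x (M\<^sub>u\<^sub>z z) - x) \<le> T * (L\<^sub>x * norm x + L\<^sub>u * norm (M\<^sub>u\<^sub>z z))"
  \<comment> \<open>constants\<close>
    and \<sigma>: "\<sigma> > 0" "\<sigma>-lipschitz_on X\<^sub>V zbar"
    and radii: "r\<^sub>z > 0" "r\<^sub>x > 0"
    and perturbed_contraction: "\<And>x z x\<^sub>p. x \<in> X\<^sub>V \<Longrightarrow> z \<in> cball (zbar x) r\<^sub>z \<Longrightarrow>
          x\<^sub>p \<in> cball x r\<^sub>x \<Longrightarrow> x\<^sub>p \<in> X\<^sub>V \<Longrightarrow>
          norm (opt x\<^sub>p z - zbar x\<^sub>p) \<le> \<kappa>hat * norm (z - zbar x) + \<sigma> * \<kappa>hat * norm (x\<^sub>p - x)"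
    and \<eta>_eq: "\<eta> = L\<^sub>x + L\<^sub>u * \<sigma>"
    and \<theta>_eq: "\<theta> = L\<^sub>u"
    and \<kappa>_eq: "\<kappa> = (\<lambda>T. \<kappa>hat * (1 + T * \<sigma> * \<theta>))"
    and \<gamma>_eq: "\<gamma> = \<sigma> * \<kappa>hat * \<eta>"
    and \<gamma>hat_eq: "\<gamma>hat = \<gamma> / sqrt a\<^sub>1"
    and abar_eq: "abar = a\<^sub>3 / a\<^sub>2"
    and \<mu>_const: "\<mu> > 0" "0 < V\<^sub>q" "V\<^sub>q \<le> Vbar" "0 < r\<^sub>q" "r\<^sub>q \<le> r\<^sub>z"
    and \<mu>: "\<And>x z T. x \<in> X \<Longrightarrow> V x \<le> V\<^sub>q \<Longrightarrow> norm (z - zbar x) \<le> r\<^sub>q \<Longrightarrow> 0 < T \<Longrightarrow> T \<le> T\<^sub>0 \<Longrightarrow>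
          \<psi> T x (M\<^sub>u\<^sub>z z) \<in> X \<and>
          V (\<psi> T x (M\<^sub>u\<^sub>z z)) \<le> (1 - T * abar) * V x + T * \<mu> * (norm (z - zbar x))\<^sup>2"
  shows "\<exists>T\<^sub>s>0. \<forall>T. 0 < T \<and> T \<le> T\<^sub>s \<longrightarrow>
           asymptotically_stable
             (\<lambda>(\<nu>, \<epsilon>). (sqrt (1 - T * abar) * \<nu> + sqrt (T * \<mu>) * \<epsilon>, T * \<gamma>hat * \<nu> + \<kappa> T * \<epsilon>))
             (0 :: real, 0 :: real)"
proof -
  have abar_pos: "abar > 0"
    using lyap_pos by (simp add: abar_eq)
  have \<gamma>hat_pos: "\<gamma>hat > 0"
    using lyap_pos evolution_const \<sigma> contraction_const
    by (simp add: \<gamma>hat_eq \<gamma>_eq \<eta>_eq add_pos_pos)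
  define w where "w = abar / (4 * \<gamma>hat)"
  have w_pos: "w > 0"
    using abar_pos \<gamma>hat_pos by (simp add: w_def)
  have "((\<lambda>T. sqrt (T * \<mu>) + w * \<kappa> T) \<longlongrightarrow> sqrt (0 * \<mu>) + w * \<kappa> 0) (at_right 0)"
    unfolding \<kappa>_eq by (intro tendsto_intros)
  moreover have "sqrt (0 * \<mu>) + w * \<kappa> 0 < w"
    using w_pos contraction_const by (simp add: \<kappa>_eq)
  ultimately have "\<forall>\<^sub>F T in at_right 0. sqrt (T * \<mu>) + w * \<kappa> T < w"
    by (rule order_tendstoD)
  then obtain b where b: "b > 0" "\<And>T. 0 < T \<Longrightarrow> T < b \<Longrightarrow> sqrt (T * \<mu>) + w * \<kappa> T < w"
    unfolding eventually_at_right_field by blast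
  show ?thesis
  proof (intro exI[of _ "min (b / 2) (1 / abar)"] conjI allI impI)
    fix T
    assume "0 < T \<and> T \<le> min (b / 2) (1 / abar)"
    then have T: "0 < T" "T < b" "T * abar \<le> 1"
      using b(1) abar_pos by (auto simp: field_simps)
    have "sqrt (1 - T * abar) + w * (T * \<gamma>hat) \<le> 1 - T * abar / 2 + T * abar / 4"
      using sqrt_one_minus_le[OF T(3)] \<gamma>hat_pos by (simp add: w_def mult.commute)
    also have "\<dots> < 1"
      using T(1) abar_pos by simp
    finally show "asymptotically_stable
        (\<lambda>(\<nu>, \<epsilon>). (sqrt (1 - T * abar) * \<nu> + sqrt (T * \<mu>) * \<epsilon>, T * \<gamma>hat * \<nu> + \<kappa> T * \<epsilon>)) (0, 0)"
      using T b(2) w_pos \<gamma>hat_pos \<mu>_const contraction_const \<sigma> evolution_const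
      by (intro asymptotically_stable_nonneg_matrix2[where w = w]) (auto simp: \<kappa>_eq \<theta>_eq)
  qed (use b(1) abar_pos in simp)
qed

end
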